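(* Every simple arrangement of at least $5$ pseudo-lines in $\mathbb{P}^2$ has a tope of size at least $5$; that is, $5+t\le\bar n(t,2)$ for every integer $t\ge 0$.
   Context: $\mathbb{P}^d$ denotes real projective $d$-space. A projective $d$-arrangement of $n$ pseudo-hyperplanes is a finite collection of $n$ pseudo-hyperplanes in $\mathbb{P}^d$ such that no point belongs to every one of them (pseudo-lines when $d=2$). It is simple if $n\ge d$ and every intersection of $d$ of the pseudo-hyperplanes is a unique distinct point. The arrangement decomposes $\mathbb{P}^d$ into a $d$-dimensional cell complex; a cell of dimension $d$ is called a tope, and the size of a tope is the number of pseudo-hyperplanes bordering it. By the Topological Representation Theorem, simple arrangements of $n$ pseudo-hyperplanes in $\mathbb{P}^d$ correspond to (reorientation classes of) uniform oriented matroids of rank $d+1$ on $n$ elements, and topes correspond to acyclic reorientations whose interior elements are precisely the pseudo-hyperplanes not bordering the tope; here an oriented matroid is acyclic if it has no positive circuit, and an element $e$ of an acyclic oriented matroid is interior if there is a signed circuit $C=(C^+,C^-)$ with $C^-=\{e\}$. For integers $t\ge 0$, $d\ge 1$, $\bar n(t,d)$ is the largest integer $m$ such that every uniform oriented matroid of rank $d+1$ with $m$ elements has an acyclic reorientation with at most $t$ interior elements; equivalently, the largest integer $m$ such that every simple arrangement of $m$ pseudo-hyperplanes in $\mathbb{P}^d$ contains a tope of size at least $m-t$. *)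

theory Defs
  imports Main "HOL-Library.Extended_Nat"
begin

text \<open>
  A signed set \<open>X = (X\<^sup>+, X\<^sup>-)\<close> is the pair of its positive and its negative part.
\<close>

type_synonym 'a signed_set = "'a set \<times> 'a set"

definition supp :: "'a signed_set \<Rightarrow> 'a set" where
  "supp X = fst X \<union> snd X"

definition opp :: "'a signed_set \<Rightarrow> 'a signed_set" where
  "opp X = (snd X, fst X)"

locale oriented_matroid =
  fixes E :: "'a set" and \<C> :: "'a signed_set set"
  assumes finite_ground: "finite E"
    and circuit_signed_subset: "X \<in> \<C> \<Longrightarrow> supp X \<subseteq> E \<and> fst X \<inter> snd X = {}"
    and circuit_nonempty: "X \<in> \<C> \<Longrightarrow> supp X \<noteq> {}"
    and circuit_symmetric: "X \<in> \<C> \<Longrightarrow> opp X \<in> \<C>"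
    and circuit_incomparable:
      "\<lbrakk>X \<in> \<C>; Y \<in> \<C>; supp X \<subseteq> supp Y\<rbrakk> \<Longrightarrow> X = Y \<or> X = opp Y"
    and circuit_elimination:
      "\<lbrakk>X \<in> \<C>; Y \<in> \<C>; X \<noteq> opp Y; e \<in> fst X \<inter> snd Y\<rbrakk> \<Longrightarrow>
        \<exists>Z\<in>\<C>. fst Z \<subseteq> (fst X \<union> fst Y) - {e} \<and> snd Z \<subseteq> (snd X \<union> snd Y) - {e}"

text \<open>The supports of the signed circuits are the circuits of the underlying matroid.\<close>

definition om_indep :: "'a signed_set set \<Rightarrow> 'a set \<Rightarrow> bool" where
  "om_indep \<C> I \<longleftrightarrow> (\<forall>X\<in>\<C>. \<not> supp X \<subseteq> I)"

definition om_rank :: "'a set \<Rightarrow> 'a signed_set set \<Rightarrow> nat" where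
  "om_rank E \<C> = Max (card ` {I. I \<subseteq> E \<and> om_indep \<C> I})"

locale uniform_oriented_matroid = oriented_matroid E \<C>
  for r :: nat and E :: "'a set" and \<C> :: "'a signed_set set" +
  assumes rank: "om_rank E \<C> = r"
    and uniform: "\<lbrakk>B \<subseteq> E; card B = r\<rbrakk> \<Longrightarrow> om_indep \<C> B"

definition reorient_set :: "'a set \<Rightarrow> 'a signed_set \<Rightarrow> 'a signed_set" where
  "reorient_set A X = ((fst X - A) \<union> (snd X \<inter> A), (snd X - A) \<union> (fst X \<inter> A))"

definition reorient :: "'a set \<Rightarrow> 'a signed_set set \<Rightarrow> 'a signed_set set" where
  "reorient A \<C> = reorient_set A ` \<C>"

definition om_acyclic :: "'a signed_set set \<Rightarrow> bool" where
  "om_acyclic \<C> \<longleftrightarrow> \<not> (\<exists>X\<in>\<C>. snd X = {})"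

definition interior_elements :: "'a set \<Rightarrow> 'a signed_set set \<Rightarrow> 'a set" where
  "interior_elements E \<C> = {e \<in> E. \<exists>X\<in>\<C>. snd X = {e}}"

text \<open>
  By the Topological Representation Theorem, the simple arrangements of \<open>n\<close> pseudo-hyperplanes
  in projective \<open>d\<close>-space are the reorientation classes of uniform oriented matroids of rank
  \<open>d + 1\<close> on \<open>n\<close> elements. In this dictionary the topes are the acyclic reorientations, encoded
  by the set \<open>A\<close> of reoriented elements (\<open>A\<close> and \<open>E - A\<close> give the same tope), and a
  pseudo-hyperplane borders a tope iff it is not an interior element of the reorientation.
\<close>

definition is_tope :: "'a set \<Rightarrow> 'a signed_set set \<Rightarrow> 'a set \<Rightarrow> bool" where
  "is_tope E \<C> A \<longleftrightarrow> A \<subseteq> E \<and> om_acyclic (reorient A \<C>)"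

definition tope_size :: "'a set \<Rightarrow> 'a signed_set set \<Rightarrow> 'a set \<Rightarrow> nat" where
  "tope_size E \<C> A = card (E - interior_elements E (reorient A \<C>))"

text \<open>
  The largest \<open>m\<close> such that every uniform oriented matroid of rank \<open>d + 1\<close> on \<open>m\<close> elements has
  an acyclic reorientation with at most \<open>t\<close> interior elements. It is taken as a supremum in
  \<^typ>\<open>enat\<close>, which is the maximum if there is one and \<open>\<infinity>\<close> if the admissible \<open>m\<close> are unbounded.
  Ground sets are finite sets of naturals, which represent all isomorphism types.
\<close>

definition nbar :: "nat \<Rightarrow> nat \<Rightarrow> enat" where
  "nbar t d = Sup (enat ` {m. \<forall>(E :: nat set) \<C>.
      uniform_oriented_matroid (d + 1) E \<C> \<and> card E = m \<longrightarrow>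
      (\<exists>A. A \<subseteq> E \<and> om_acyclic (reorient A \<C>) \<and>
           card (interior_elements E (reorient A \<C>)) \<le> t)})"

lemma supp_reorient_set [simp]: "supp (reorient_set A X) = supp X"
  by (auto simp: supp_def reorient_set_def)

lemma opp_reorient_set: "opp (reorient_set A X) = reorient_set A (opp X)"
  by (auto simp: opp_def reorient_set_def)

lemma reorient_set_idem [simp]: "reorient_set A (reorient_set A X) = X"
  by (cases X) (auto simp: reorient_set_def)

lemma om_indep_reorient [simp]: "om_indep (reorient A \<C>) I = om_indep \<C> I"
  by (simp add: om_indep_def reorient_def)

lemma om_rank_reorient [simp]: "om_rank E (reorient A \<C>) = om_rank E \<C>"
  by (simp add: om_rank_def)

lemma opp_opp [simp]: "opp (opp X) = X"
  by (simp add: opp_def)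

lemma (in oriented_matroid) oriented_matroid_reorient: "oriented_matroid E (reorient A \<C>)"
proof
  show "finite E" by (rule finite_ground)
next
  fix X assume "X \<in> reorient A \<C>"
  then obtain X' where X': "X' \<in> \<C>" "X = reorient_set A X'" by (auto simp: reorient_def)
  show "supp X \<subseteq> E \<and> fst X \<inter> snd X = {}"
    using circuit_signed_subset[OF X'(1)] X'(2) by (auto simp: supp_def reorient_set_def)
  show "supp X \<noteq> {}" using circuit_nonempty[OF X'(1)] X'(2) by simp
  show "opp X \<in> reorient A \<C>"
    using circuit_symmetric[OF X'(1)] X'(2) by (auto simp: reorient_def opp_reorient_set)
next
  fix X Y assume "X \<in> reorient A \<C>" "Y \<in> reorient A \<C>" and s: "supp X \<subseteq> supp Y"
  then obtain X' Y' where *: "X' \<in> \<C>" "X = reorient_set A X'" "Y' \<in> \<C>" "Y = reorient_set A Y'"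
    by (auto simp: reorient_def)
  then have "X' = Y' \<or> X' = opp Y'" using circuit_incomparable[OF *(1,3)] s by simp
  then show "X = Y \<or> X = opp Y" using * by (auto simp: opp_reorient_set)
next
  fix X Y e
  assume "X \<in> reorient A \<C>" "Y \<in> reorient A \<C>" and n: "X \<noteq> opp Y" and e: "e \<in> fst X \<inter> snd Y"
  then obtain X' Y' where *: "X' \<in> \<C>" "X = reorient_set A X'" "Y' \<in> \<C>" "Y = reorient_set A Y'"
    by (auto simp: reorient_def)
  have n': "X' \<noteq> opp Y'" "Y' \<noteq> opp X'" using n * by (auto simp: opp_reorient_set)
  have "\<exists>Z\<in>\<C>. fst Z \<subseteq> (fst X' \<union> fst Y') - {e} \<and> snd Z \<subseteq> (snd X' \<union> snd Y') - {e}"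
  proof (cases "e \<in> A")
    case False
    then have "e \<in> fst X' \<inter> snd Y'" using e * by (auto simp: reorient_set_def)
    then show ?thesis using circuit_elimination[OF *(1,3) n'(1)] by blast
  next
    case True
    then have "e \<in> fst Y' \<inter> snd X'" using e * by (auto simp: reorient_set_def)
    then show ?thesis using circuit_elimination[OF *(3,1) n'(2)] by blast
  qed
  then obtain Z where Z: "Z \<in> \<C>" "fst Z \<subseteq> (fst X' \<union> fst Y') - {e}" "snd Z \<subseteq> (snd X' \<union> snd Y') - {e}"
    by blast
  have "reorient_set A Z \<in> reorient A \<C>" using Z(1) by (simp add: reorient_def)
  moreover have "fst (reorient_set A Z) \<subseteq> (fst X \<union> fst Y) - {e}"
    and "snd (reorient_set A Z) \<subseteq> (snd X \<union> snd Y) - {e}"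
    using Z(2,3) * by (auto simp: reorient_set_def)
  ultimately show "\<exists>Z\<in>reorient A \<C>. fst Z \<subseteq> (fst X \<union> fst Y) - {e} \<and> snd Z \<subseteq> (snd X \<union> snd Y) - {e}"
    by blast
qed

lemma (in uniform_oriented_matroid) uniform_oriented_matroid_reorient:
  "uniform_oriented_matroid r E (reorient A \<C>)"
  by (intro uniform_oriented_matroid.intro oriented_matroid_reorient
        uniform_oriented_matroid_axioms.intro) (simp_all add: rank uniform)

end

theory Submission
  imports Defs
begin

text \<open>
  Build the arrangement by adding one pseudo-line at a time. Any five pseudo-lines have a tope that
  is a pentagon: up to reorientation and relabelling there is only one uniform oriented matroid
  of rank 3 on five elements, the alternating one (\<open>alternating_five\<close>). Suppose now that the
  pseudo-lines in \<open>F\<close> have a tope with \<open>k \<ge> 5\<close> sides, and add a pseudo-line \<open>e\<close>. If \<open>e\<close> misses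
  the tope, then the tope and all its sides remain. If \<open>e\<close> crosses the tope, it divides it into
  two topes; \<open>e\<close> is a side of both, every old side is a side of at least one of them, and the
  two sides at which \<open>e\<close> enters and leaves the old tope are sides of both. The two parts
  together have at least \<open>k + 4 \<ge> 9\<close> sides, so one of them has at least five
  (\<open>five_extremes_insert\<close>).

  In terms of circuits, the two parts correspond to the two orientations of \<open>e\<close>, and \<open>e\<close> misses
  the tope iff it is an interior element for one of them. The sides where \<open>e\<close> is crossed are the
  extreme elements of the contraction of \<open>e\<close>, which is acyclic of rank 2: in geometric terms the
  end points of a finite set of points on a line (\<open>two_extremes_mod_element\<close>). Everything rests on
  one application of circuit elimination (\<open>acyclic_insert_interior\<close>): adding an interior element
  does not destroy acyclicity. Applied to contractions, this also shows that extreme elements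
  remain extreme, because an element is extreme iff contracting it leaves an acyclic oriented
  matroid.
\<close>

section \<open>Acyclicity and extreme elements of minors\<close>

lemma reorient_set_comp:
  "reorient_set A (reorient_set B X) = reorient_set ((A - B) \<union> (B - A)) X"
  by (cases X) (auto simp: reorient_set_def)

lemma reorient_comp: "reorient A (reorient B \<C>) = reorient ((A - B) \<union> (B - A)) \<C>"
  by (simp add: reorient_def image_image reorient_set_comp)

lemma reorient_empty [simp]: "reorient {} \<C> = \<C>"
  by (simp add: reorient_def reorient_set_def)

text \<open>
  This is acyclicity of the minor on \<open>G\<close> obtained by contracting \<open>D\<close> and deleting all remaining
  elements: a positive circuit of that minor is the trace on \<open>G\<close> of a circuit that is nonnegative
  outside \<open>D\<close>, and conversely such a trace contains one unless it is empty. Phrasing it with the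
  circuits of the whole oriented matroid avoids describing the circuits of the minor. A circuit
  inside \<open>D\<close> violates the condition, so dependent sets \<open>D\<close> are excluded.
\<close>

definition acyclic_mod :: "'a set \<Rightarrow> 'a set \<Rightarrow> 'a signed_set set \<Rightarrow> bool" where
  "acyclic_mod D G \<C> \<longleftrightarrow> (\<forall>X\<in>\<C>. supp X \<subseteq> D \<union> G \<longrightarrow> \<not> snd X \<subseteq> D)"

text \<open>
  In the geometric picture, contracting \<open>f\<close> means restricting the arrangement to the pseudo-line
  \<open>f\<close>. A tope remains on \<open>f\<close> with the given signs exactly when \<open>f\<close> borders the given tope. In
  an acyclic oriented matroid the extreme elements are those that are not interior, as
  \<open>extremes_eq\<close> shows.
\<close>

definition extremes :: "'a set \<Rightarrow> 'a set \<Rightarrow> 'a signed_set set \<Rightarrow> 'a set" where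
  "extremes D G \<C> = {f \<in> G. acyclic_mod (insert f D) (G - {f}) \<C>}"

lemma supp_opp [simp]: "supp (opp X) = supp X"
  by (auto simp: supp_def opp_def)

lemma extremes_subset: "extremes D G \<C> \<subseteq> G"
  by (auto simp: extremes_def)

lemma finite_extremes: "finite G \<Longrightarrow> finite (extremes D G \<C>)"
  by (rule finite_subset[OF extremes_subset])

lemma (in oriented_matroid) om_acyclic_iff: "om_acyclic \<C> \<longleftrightarrow> acyclic_mod {} E \<C>"
  using circuit_signed_subset by (auto simp: om_acyclic_def acyclic_mod_def)

lemma (in oriented_matroid) extremes_eq:
  assumes "acyclic_mod {} E \<C>"
  shows "extremes {} E \<C> = E - interior_elements E \<C>"
proof -
  have X: "supp X \<subseteq> E" "snd X \<noteq> {}" if "X \<in> \<C>" for X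
    using that assms circuit_signed_subset unfolding acyclic_mod_def by auto
  have "acyclic_mod {f} (E - {f}) \<C> \<longleftrightarrow> (\<forall>X\<in>\<C>. snd X \<noteq> {f})" if "f \<in> E" for f
  proof -
    have "{f} \<union> (E - {f}) = E" using that by blast
    then show ?thesis
      using X by (simp add: acyclic_mod_def subset_singleton_iff)
  qed
  then show ?thesis
    by (auto simp: extremes_def interior_elements_def)
qed

section \<open>Reorienting and uncontracting an element\<close>

lemma reorient_set_notin: "e \<notin> supp X \<Longrightarrow> reorient_set {e} X = X"
  by (cases X) (auto simp: reorient_set_def supp_def)

text \<open>
  The signs of contracted elements are irrelevant to acyclicity. Hence a tope of the contraction
  of \<open>e\<close> lies on the boundary of topes on both sides of \<open>e\<close>.
\<close>

lemma acyclic_mod_reorient_contracted: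
  assumes "D' \<subseteq> D"
  shows "acyclic_mod D G (reorient D' \<C>) = acyclic_mod D G \<C>"
proof -
  have "snd (reorient_set D' X) \<subseteq> D \<longleftrightarrow> snd X \<subseteq> D" for X :: "'a signed_set"
    using assms by (auto simp: reorient_set_def)
  then show ?thesis by (simp add: acyclic_mod_def reorient_def)
qed

lemma acyclic_mod_reorient_outside:
  assumes "e \<notin> D \<union> G"
  shows "acyclic_mod D G (reorient {e} \<C>) = acyclic_mod D G \<C>"
proof -
  have "reorient_set {e} X = X" if "supp X \<subseteq> D \<union> G" for X
    using assms that by (intro reorient_set_notin) blast
  then show ?thesis by (auto simp: acyclic_mod_def reorient_def)
qed

lemma extremes_reorient_contracted:
  "D' \<subseteq> D \<Longrightarrow> extremes D G (reorient D' \<C>) = extremes D G \<C>"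
  by (simp add: extremes_def acyclic_mod_reorient_contracted subset_insertI2)

lemma extremes_reorient_outside:
  assumes "e \<notin> D \<union> G"
  shows "extremes D G (reorient {e} \<C>) = extremes D G \<C>"
proof -
  have "acyclic_mod (insert f D) (G - {f}) (reorient {e} \<C>)
      = acyclic_mod (insert f D) (G - {f}) \<C>" if "f \<in> G" for f
    using assms that by (intro acyclic_mod_reorient_outside) auto
  then show ?thesis by (auto simp: extremes_def)
qed

text \<open>
  A tope on the pseudo-line \<open>e\<close> is a face of a tope of the whole arrangement, and the
  pseudo-lines bordering the face also border that tope.
\<close>

lemma acyclic_mod_uncontract:
  "acyclic_mod (insert e D) G \<C> \<Longrightarrow> acyclic_mod D (insert e G) \<C>"
  by (auto simp: acyclic_mod_def)

lemma extremes_uncontract: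
  assumes "e \<notin> G"
  shows "extremes (insert e D) G \<C> \<subseteq> extremes D (insert e G) \<C>"
proof
  fix f assume f: "f \<in> extremes (insert e D) G \<C>"
  then have "insert e (G - {f}) = insert e G - {f}"
    using assms by (auto simp: extremes_def)
  then show "f \<in> extremes D (insert e G) \<C>"
    using f acyclic_mod_uncontract[of e "insert f D" "G - {f}" \<C>]
    by (auto simp: extremes_def insert_commute)
qed

section \<open>Enumerating a transitive tournament\<close>

lemma ex_sorted_wrt_tournament:
  assumes "finite S"
    and "\<And>x y. x \<in> S \<Longrightarrow> y \<in> S \<Longrightarrow> x \<noteq> y \<Longrightarrow> L x y \<or> L y x"
    and "\<And>x y z. x \<in> S \<Longrightarrow> y \<in> S \<Longrightarrow> z \<in> S \<Longrightarrow> L x y \<Longrightarrow> L y z \<Longrightarrow> L x z"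
  shows "\<exists>xs. set xs = S \<and> distinct xs \<and> sorted_wrt L xs"
  using assms
proof (induction S)
  case empty
  show ?case by simp
next
  case (insert x S)
  have "\<exists>xs. set xs = S \<and> distinct xs \<and> sorted_wrt L xs"
  proof (rule insert.IH)
    show "L y z \<or> L z y" if "y \<in> S" "z \<in> S" "y \<noteq> z" for y z
      using insert.prems(1)[of y z] that by simp
    show "L u w" if "u \<in> S" "v \<in> S" "w \<in> S" "L u v" "L v w" for u v w
      using insert.prems(2)[of u v w] that by simp
  qed
  then obtain xs where xs: "set xs = S" "distinct xs" "sorted_wrt L xs" by blast
  \<comment> \<open>By transitivity the elements below \<open>x\<close> are an initial segment of the enumeration.\<close>
  let ?ys = "filter (\<lambda>y. L y x) xs @ x # filter (\<lambda>y. \<not> L y x) xs"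
  have above: "L x z" if "z \<in> S" "\<not> L z x" for z
    using that insert.prems(1)[of x z] insert.hyps(2) by auto
  moreover have "L y z" if "y \<in> S" "z \<in> S" "L y x" "\<not> L z x" for y z
    using that insert.prems(2)[of y x z] above[of z] by simp
  ultimately have "sorted_wrt L ?ys"
    using xs by (auto simp: sorted_wrt_append sorted_wrt_filter)
  moreover have "set ?ys = insert x S" "distinct ?ys" using xs insert.hyps by auto
  ultimately show ?case by blast
qed

section \<open>Circuits and interior elements of uniform oriented matroids\<close>

context uniform_oriented_matroid
begin

lemma card_indep_le:
  assumes "I \<subseteq> E" "om_indep \<C> I"
  shows "card I \<le> r"
proof -
  have "finite (card ` {I. I \<subseteq> E \<and> om_indep \<C> I})"
    using finite_ground by simp
  then show ?thesis
    using Max_ge[of _ "card I"] assms rank unfolding om_rank_def by blast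
qed

lemma card_supp_circuit:
  assumes "r \<le> card E" "X \<in> \<C>"
  shows "card (supp X) = r + 1"
proof -
  have sub: "supp Y \<subseteq> E" if "Y \<in> \<C>" for Y
    using circuit_signed_subset that by blast
  \<comment> \<open>A smaller support would extend to a set of \<open>r\<close> elements, which is independent.\<close>
  have "r < card (supp X)"
  proof (rule ccontr)
    assume "\<not> r < card (supp X)"
    then obtain B where "supp X \<subseteq> B" "B \<subseteq> E" "card B = r"
      using exists_subset_between[of "supp X" r E] assms finite_ground sub by auto
    then show False using uniform assms unfolding om_indep_def by blast
  qed
  then obtain T where T: "T \<subseteq> supp X" "card T = r + 1"
    by (metis Suc_eq_plus1 Suc_leI obtain_subset_with_card_n)
  \<comment> \<open>The set \<open>T\<close> is too large to be independent, and its circuit has the support of \<open>X\<close> by minimality.\<close>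
  then have "\<not> om_indep \<C> T" using card_indep_le[of T] sub[OF assms(2)] by auto
  then obtain Y where Y: "Y \<in> \<C>" "supp Y \<subseteq> T" by (auto simp: om_indep_def)
  then have "supp X = supp Y"
    using circuit_incomparable[OF Y(1) assms(2)] T supp_opp by (metis order_trans)
  then show ?thesis using Y T by auto
qed

lemma circuit_on:
  assumes "r \<le> card E" "T \<subseteq> E" "card T = r + 1"
  obtains X where "X \<in> \<C>" "supp X = T"
proof -
  have "\<not> om_indep \<C> T" using card_indep_le[of T] assms by auto
  then obtain Y where Y: "Y \<in> \<C>" "supp Y \<subseteq> T" by (auto simp: om_indep_def)
  moreover have "finite T" using assms finite_ground finite_subset by blast
  ultimately have "supp Y = T"
    using card_subset_eq[of T "supp Y"] card_supp_circuit[OF assms(1), of Y] assms by auto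
  then show thesis using Y that by blast
qed

text \<open>
  A circuit that violates acyclicity after \<open>p\<close> is added has \<open>p\<close> on its positive side. The circuit
  \<open>X\<close> which makes \<open>p\<close> interior has \<open>p\<close> on its negative side, so eliminating \<open>p\<close> between the two
  gives a violation in \<open>G\<close>. The bound on \<open>D\<close> makes elimination applicable: if the circuits were
  opposite, their support would be contained in \<open>insert p D\<close>, which has at most \<open>r\<close> elements.
\<close>

lemma acyclic_insert_interior:
  assumes "r \<le> card E" and D: "finite D" "card D < r" "p \<notin> D"
    and acyc: "acyclic_mod D G \<C>"
    and X: "X \<in> \<C>" "supp X \<subseteq> D \<union> insert p G" "p \<in> snd X" "snd X \<subseteq> insert p D"
  shows "acyclic_mod D (insert p G) \<C>"
  unfolding acyclic_mod_def
proof (intro ballI impI notI)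
  fix Y assume Y: "Y \<in> \<C>" "supp Y \<subseteq> D \<union> insert p G" "snd Y \<subseteq> D"
  have "p \<in> supp Y" using Y acyc unfolding acyclic_mod_def by blast
  then have pY: "p \<in> fst Y" using Y D by (auto simp: supp_def)
  have "Y \<noteq> opp X"
  proof
    assume "Y = opp X"
    then have "supp X \<subseteq> insert p D" using X Y by (auto simp: opp_def supp_def)
    then have "card (supp X) \<le> card (insert p D)"
      using D by (intro card_mono) auto
    then show False using card_supp_circuit[OF assms(1) X(1)] D by simp
  qed
  then obtain Z where Z: "Z \<in> \<C>" "fst Z \<subseteq> (fst Y \<union> fst X) - {p}" "snd Z \<subseteq> (snd Y \<union> snd X) - {p}"
    using circuit_elimination[OF Y(1) X(1), of p] pY X(3) by blast
  have "snd Z \<subseteq> D" using Z X Y by blast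
  moreover have "supp Z \<subseteq> D \<union> G" using Z X Y unfolding supp_def by blast
  ultimately show False using acyc Z(1) unfolding acyclic_mod_def by blast
qed

text \<open>
  For \<open>f\<close> extreme in \<open>G\<close>, this is the preceding lemma with \<open>f\<close> contracted as well: the circuit
  that makes \<open>p\<close> interior still does so after the contraction.
\<close>

lemma extremes_insert_interior:
  assumes "r \<le> card E" and D: "finite D" "card D + 1 < r" "p \<notin> D" "p \<notin> G"
    and X: "X \<in> \<C>" "supp X \<subseteq> D \<union> insert p G" "p \<in> snd X" "snd X \<subseteq> insert p D"
  shows "extremes D G \<C> \<subseteq> extremes D (insert p G) \<C>"
proof
  fix f assume "f \<in> extremes D G \<C>"
  then have f: "f \<in> G" "acyclic_mod (insert f D) (G - {f}) \<C>" by (auto simp: extremes_def)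
  have "acyclic_mod (insert f D) (insert p (G - {f})) \<C>"
  proof (rule acyclic_insert_interior[OF assms(1) _ _ _ f(2) X(1) _ X(3)])
    show "card (insert f D) < r" using D by (simp add: card_insert_if)
    show "p \<notin> insert f D" using D f by auto
  qed (use D X in auto)
  moreover have "insert p (G - {f}) = insert p G - {f}" using f D by auto
  ultimately show "f \<in> extremes D (insert p G) \<C>"
    using f by (auto simp: extremes_def)
qed

section \<open>The two end points on a pseudo-line\<close>

text \<open>
  The contraction of \<open>e\<close> has rank 2, so it orders the elements of \<open>G\<close> on a line up to reversal. In
  a circuit through \<open>e\<close> and three elements of \<open>G\<close>, one of the three has a sign different from that
  of the other two: it lies between them and is interior. Removing such an element creates no new
  extreme elements, and one can continue until two elements are left. These two are extreme since
  they are independent together with \<open>e\<close>.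
\<close>

lemma two_extremes_mod_element:
  assumes "r = 3" "r \<le> card E" "e \<in> E" "G \<subseteq> E" "e \<notin> G" "2 \<le> card G" "acyclic_mod {e} G \<C>"
  shows "2 \<le> card (extremes {e} G \<C>)"
  using assms(4-7)
proof (induction "card G" arbitrary: G)
  case 0
  then show ?case by simp
next
  case (Suc n)
  have finG: "finite G" using Suc.prems finite_ground finite_subset by blast
  show ?case
  proof (cases "card G = 2")
    case True
    have "\<not> supp X \<subseteq> {e} \<union> G" if "X \<in> \<C>" for X
    proof
      assume "supp X \<subseteq> {e} \<union> G"
      then have "card (supp X) \<le> card ({e} \<union> G)" using finG by (intro card_mono) auto
      then show False
        using True finG card_supp_circuit[OF assms(2) that] assms(1) by (simp add: card_insert_if split: if_splits)
    qed
    then have "extremes {e} G \<C> = G" by (auto simp: extremes_def acyclic_mod_def)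
    then show ?thesis using True by simp
  next
    case False
    then have "3 \<le> card G" using Suc.prems by simp
    then obtain T where T: "T \<subseteq> G" "card T = 3" by (metis obtain_subset_with_card_n)
    then obtain a b c where abc: "T = {a, b, c}" "a \<noteq> b" "a \<noteq> c" "b \<noteq> c"
      by (auto simp: card_3_iff)
    have "card (insert e T) = 4" using T Suc.prems finG finite_subset[of T G]
      by (subst card_insert_disjoint) auto
    obtain Y where Y: "Y \<in> \<C>" "supp Y = insert e T"
    proof (rule circuit_on[OF assms(2), of "insert e T"])
      show "insert e T \<subseteq> E" using assms(3) T Suc.prems by blast
      show "card (insert e T) = r + 1" using \<open>card (insert e T) = 4\<close> assms(1) by simp
    qed
    \<comment> \<open>Among three signs at most one differs from the majority; \<open>p\<close> is the middle element.\<close>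
    have "fst Y \<inter> snd Y = {}" using circuit_signed_subset[OF Y(1)] by simp
    then have "(\<exists>p. snd Y \<inter> T \<subseteq> {p}) \<or> (\<exists>p. snd (opp Y) \<inter> T \<subseteq> {p})"
      unfolding abc(1) opp_def snd_conv by blast
    then obtain X p where "X \<in> {Y, opp Y}" and Xp: "snd X \<inter> T \<subseteq> {p}"
      by blast
    then have X: "X \<in> \<C>" "supp X = insert e T"
      using Y circuit_symmetric[OF Y(1)] supp_opp[of Y] by auto
    have sX: "snd X \<subseteq> insert e T" using X by (auto simp: supp_def)
    have pX: "p \<in> snd X" "p \<in> T"
    proof -
      have "\<not> snd X \<subseteq> {e}"
        using Suc.prems X T unfolding acyclic_mod_def by blast
      then show "p \<in> snd X" "p \<in> T" using X Xp sX by auto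
    qed
    let ?G = "G - {p}"
    have ins: "insert p ?G = G" using pX T by blast
    have acyc: "acyclic_mod {e} ?G \<C>" 
      using Suc.prems unfolding acyclic_mod_def by blast
    have "p \<noteq> e" using pX T Suc.prems by auto
    have "2 \<le> card (extremes {e} ?G \<C>)"
      using Suc.hyps(2) \<open>3 \<le> card G\<close> pX T finG Suc.prems acyc by (intro Suc.hyps(1)) auto
    moreover have "extremes {e} ?G \<C> \<subseteq> extremes {e} (insert p ?G) \<C>"
    proof (rule extremes_insert_interior[OF assms(2) _ _ _ _ X(1) _ pX(1)])
      show "supp X \<subseteq> {e} \<union> insert p ?G" using X T by blast
      show "snd X \<subseteq> insert p {e}" using Xp sX by blast
    qed (use \<open>p \<noteq> e\<close> assms(1) in auto)
    ultimately show ?thesis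
      unfolding ins using card_mono[OF finite_extremes[OF finG]] order_trans by blast
  qed
qed

section \<open>Adding a pseudo-line\<close>

text \<open>
  Suppose that a side \<open>f\<close> is lost for both orientations of \<open>e\<close>. A circuit by which it is lost for
  the reversed orientation makes \<open>e\<close>, as given, interior in the contraction of \<open>f\<close>. Adding \<open>e\<close>
  therefore keeps that contraction acyclic, so \<open>f\<close> is a side for the given orientation.
\<close>

lemma extreme_for_one_sign:
  assumes "r \<le> card E" "3 \<le> r" "e \<notin> F"
  shows "extremes {} F \<C> \<subseteq>
    extremes {} (insert e F) \<C> \<union> extremes {} (insert e F) (reorient {e} \<C>)"
proof (rule subsetI, rule ccontr)
  fix f assume f: "f \<in> extremes {} F \<C>"
    and n: "f \<notin> extremes {} (insert e F) \<C> \<union> extremes {} (insert e F) (reorient {e} \<C>)"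
  have acyc: "acyclic_mod {f} (F - {f}) \<C>" "f \<in> F" using f by (auto simp: extremes_def)
  then have "e \<noteq> f" using assms by auto
  then have eq: "insert e F - {f} = insert e (F - {f})" by auto
  have "\<not> acyclic_mod {f} (insert e (F - {f})) (reorient {e} \<C>)"
    using n acyc(2) by (simp add: extremes_def eq)
  then obtain X where X: "X \<in> \<C>" "supp X \<subseteq> {f} \<union> insert e (F - {f})"
      "snd (reorient_set {e} X) \<subseteq> {f}"
    by (auto simp: acyclic_mod_def reorient_def)
  have "e \<in> snd X"
  proof (rule ccontr)
    assume a: "e \<notin> snd X"
    have "e \<notin> fst X" using X(3) a \<open>e \<noteq> f\<close> by (auto simp: reorient_set_def)
    with a have "e \<notin> supp X" by (simp add: supp_def)
    then show False using X acyc(1) reorient_set_notin[of e X] unfolding acyclic_mod_def by auto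
  qed
  moreover have "snd X \<subseteq> insert e {f}" using X(3) by (auto simp: reorient_set_def)
  ultimately have "acyclic_mod {f} (insert e (F - {f})) \<C>"
    using acyclic_insert_interior[OF assms(1) _ _ _ acyc(1) X(1,2)] assms(2) \<open>e \<noteq> f\<close> by simp
  then show False using n acyc(2) by (simp add: extremes_def eq)
qed

text \<open>
  The added pseudo-line \<open>e\<close> crosses the tope exactly when the tope leaves a trace on \<open>e\<close>, that is,
  when the contraction of \<open>e\<close> is acyclic. For a crossing, the sides of the two parts are counted by
  inclusion and exclusion: at least \<open>5 + 1\<close> elements belong to the union and at least \<open>2 + 1\<close> to
  the intersection, where \<open>e\<close> accounts for the additional one in both.
\<close>

lemma five_extremes_insert:
  assumes "r = 3" "r \<le> card E" "F \<subseteq> E" "e \<in> E" "e \<notin> F"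
    and acyc: "acyclic_mod {} F \<C>" and five: "5 \<le> card (extremes {} F \<C>)"
  shows "\<exists>A\<subseteq>{e}. acyclic_mod {} (insert e F) (reorient A \<C>) \<and>
    5 \<le> card (extremes {} (insert e F) (reorient A \<C>))"
proof (cases "acyclic_mod {e} F \<C>")
  case False
  then obtain X where X: "X \<in> \<C>" "supp X \<subseteq> insert e F" "snd X \<subseteq> {e}"
    by (auto simp: acyclic_mod_def)
  have "e \<in> supp X" using X acyc assms(5) unfolding acyclic_mod_def supp_def by blast
  \<comment> \<open>Orient \<open>e\<close> so that it is negative in the obstructing circuit \<open>X\<close>, hence interior.\<close>
  define A where "A = (if e \<in> snd X then {} else {e})"
  interpret A: uniform_oriented_matroid r E "reorient A \<C>"
    by (rule uniform_oriented_matroid_reorient)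
  have 1: "reorient_set A X \<in> reorient A \<C>" using X by (simp add: reorient_def)
  have 2: "e \<in> snd (reorient_set A X)" "snd (reorient_set A X) \<subseteq> {e}"
    using X \<open>e \<in> supp X\<close> by (auto simp: A_def reorient_set_def supp_def)
  have 3: "acyclic_mod {} F (reorient A \<C>)" "extremes {} F (reorient A \<C>) = extremes {} F \<C>"
    using acyc assms(5) by (auto simp: A_def acyclic_mod_reorient_outside extremes_reorient_outside)
  have "acyclic_mod {} (insert e F) (reorient A \<C>)"
    using A.acyclic_insert_interior[OF assms(2) _ _ _ 3(1) 1, of e] 2 X assms(1) by simp
  moreover have sub: "extremes {} F \<C> \<subseteq> extremes {} (insert e F) (reorient A \<C>)"
    using A.extremes_insert_interior[OF assms(2) _ _ _ assms(5) 1, of "{}"] 2 3 X assms(1) by simp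
  moreover have "finite (extremes {} (insert e F) (reorient A \<C>))"
    using finite_subset[OF assms(3) finite_ground] by (simp add: finite_extremes)
  ultimately show ?thesis
    using five card_mono[OF _ sub] by (intro exI[of _ A]) (auto simp: A_def)
next
  case True
  define P where "P = extremes {} (insert e F) \<C>"
  define N where "N = extremes {} (insert e F) (reorient {e} \<C>)"
  have finF: "finite F" using assms(3) finite_ground finite_subset by blast
  have fin: "finite P" "finite N"
    using finF by (simp_all add: P_def N_def finite_extremes)
  have T: "acyclic_mod {e} F (reorient {e} \<C>)"
    using True by (simp add: acyclic_mod_reorient_contracted)
  have old: "extremes {} F \<C> \<subseteq> P \<union> N"
    using extreme_for_one_sign[OF assms(2) _ assms(5)] assms(1) by (simp add: P_def N_def)
  have cut: "extremes {e} F \<C> \<subseteq> P \<inter> N"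
    using extremes_uncontract[OF assms(5), of "{}" \<C>]
      extremes_uncontract[OF assms(5), of "{}" "reorient {e} \<C>"]
    by (simp add: P_def N_def extremes_reorient_contracted)
  have eP: "e \<in> P \<inter> N"
    using True T assms(5) by (simp add: P_def N_def extremes_def)
  have "e \<notin> extremes {} F \<C>" "e \<notin> extremes {e} F \<C>" using assms(5) by (auto simp: extremes_def)
  have "5 \<le> card F" using five card_mono[OF finF extremes_subset] order_trans by blast
  then have two: "2 \<le> card (extremes {e} F \<C>)"
    using two_extremes_mod_element[OF assms(1,2,4,3,5) _ True] by simp
  have "card (insert e (extremes {} F \<C>)) \<le> card (P \<union> N)"
    using old eP fin by (intro card_mono) auto
  moreover have "card (insert e (extremes {e} F \<C>)) \<le> card (P \<inter> N)"
    using cut eP fin by (intro card_mono) auto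
  moreover have "finite (extremes {} F \<C>)" "finite (extremes {e} F \<C>)"
    using finF by (simp_all add: finite_extremes)
  ultimately have "5 \<le> card P \<or> 5 \<le> card N"
    using five two card_Un_Int[OF fin] \<open>e \<notin> extremes {} F \<C>\<close> \<open>e \<notin> extremes {e} F \<C>\<close>
    by (simp, arith)
  moreover have "acyclic_mod {} (insert e F) \<C>" "acyclic_mod {} (insert e F) (reorient {e} \<C>)"
    using True T by (auto intro: acyclic_mod_uncontract)
  ultimately show ?thesis
  proof (elim disjE, goal_cases)
    case 1
    then show ?case by (intro exI[of _ "{}"]) (simp add: P_def)
  next
    case 2
    then show ?case by (intro exI[of _ "{e}"]) (simp add: N_def)
  qed
qed

section \<open>The pentagon\<close>

text \<open>
  Fix an element \<open>q\<close> and reorient so that the circuit \<open>P\<close> avoiding \<open>q\<close> is positive. Let \<open>K i\<close> be the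
  circuit avoiding \<open>i\<close> in which \<open>q\<close> is negative. Eliminating \<open>q\<close> between one of these
  and the opposite of another must give \<open>P\<close> or its opposite. All signs there agree, and comparing
  them element by element shows that the relation "\<open>j\<close> is positive in \<open>K i\<close>" is a transitive
  tournament. This is the order by angle of the five vectors of a Gale
  dual, with \<open>q\<close> first and then \<open>a\<close>, \<open>b\<close>, \<open>c\<close>, \<open>d\<close>. In every circuit the elements before the
  avoided one are negative and those after it are positive. Reorienting every other element,
  \<open>a\<close> and \<open>c\<close>, leaves two elements of either sign in every circuit, so no circuit is positive or
  makes an element interior.
\<close>

lemma alternating_five:
  assumes "r = 3" "r \<le> card E" "F \<subseteq> E" "card F = 5"
  shows "\<exists>A\<subseteq>F. acyclic_mod {} F (reorient A \<C>) \<and> extremes {} F (reorient A \<C>) = F"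
proof -
  obtain q S where F: "F = insert q S" "q \<notin> S" "card S = 4"
    using assms(4) card_Suc_eq[of F 4] by auto
  obtain P0 where P0: "P0 \<in> \<C>" "supp P0 = S"
    using circuit_on[OF assms(2), of S] F assms(1,3) by auto
  define B where "B = snd P0"
  define \<D> where "\<D> = reorient B \<C>"
  interpret N: uniform_oriented_matroid r E \<D>
    unfolding \<D>_def by (rule uniform_oriented_matroid_reorient)
  define P where "P = reorient_set B P0"
  have P: "P \<in> \<D>" "snd P = {}" "fst P = S"
    using P0 circuit_signed_subset[OF P0(1)]
    by (auto simp: \<D>_def P_def reorient_def B_def reorient_set_def supp_def)
  have finS: "finite S" using F by (metis card.infinite zero_neq_numeral)
  have "\<exists>X\<in>\<D>. supp X = F - {i} \<and> q \<in> snd X" if "i \<in> S" for i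
  proof -
    have "card (F - {i}) = 4" using F finS that by simp
    then obtain X where X: "X \<in> \<D>" "supp X = F - {i}"
      using N.circuit_on[OF assms(2), of "F - {i}"] assms(1,3) by auto
    have "q \<in> snd X \<or> q \<in> snd (opp X)"
      using X(2) F that by (auto simp: supp_def opp_def)
    then show ?thesis using X N.circuit_symmetric supp_opp by metis
  qed
  then obtain K where K: "\<And>i. i \<in> S \<Longrightarrow> K i \<in> \<D>" "\<And>i. i \<in> S \<Longrightarrow> supp (K i) = F - {i}"
      "\<And>i. i \<in> S \<Longrightarrow> q \<in> snd (K i)"
    by metis
  define L where "L i j \<longleftrightarrow> j \<in> fst (K i)" for i j
  have nL: "j \<in> snd (K i) \<longleftrightarrow> \<not> L i j" if "i \<in> S" "j \<in> S" "i \<noteq> j" for i j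
    using K(2)[OF that(1)] N.circuit_signed_subset[OF K(1)[OF that(1)]] that F
    unfolding L_def supp_def by blast
  have irr: "\<not> L i i" "i \<notin> snd (K i)" if "i \<in> S" for i
    using K(2)[OF that] by (auto simp: L_def supp_def)
  have elim: "(L i j \<and> \<not> L j i \<and> (\<forall>k\<in>S. L j k \<longrightarrow> L i k)) \<or>
      (L j i \<and> \<not> L i j \<and> (\<forall>k\<in>S. L i k \<longrightarrow> L j k))"
    if ij: "i \<in> S" "j \<in> S" "i \<noteq> j" for i j
  proof -
    have "i \<in> supp (K j)" "i \<notin> supp (K i)"
      using K(2)[OF ij(1)] K(2)[OF ij(2)] ij F(1) by simp_all
    then have "K i \<noteq> K j" by metis
    then have "opp (K i) \<noteq> opp (K j)" by (metis opp_opp)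
    then obtain Z where Z: "Z \<in> \<D>" "fst Z \<subseteq> (snd (K i) \<union> fst (K j)) - {q}"
        "snd Z \<subseteq> (fst (K i) \<union> snd (K j)) - {q}"
      using N.circuit_elimination[of "opp (K i)" "K j" q] K ij N.circuit_symmetric
      by (auto simp: opp_def)
    have "supp Z \<subseteq> S" using Z K(2)[OF ij(1)] K(2)[OF ij(2)] F unfolding supp_def by blast
    then have "Z = P \<or> Z = opp P"
      using N.circuit_incomparable[OF Z(1) P(1)] P by (simp add: supp_def)
    then have "S \<subseteq> snd (K i) \<union> fst (K j) \<or> S \<subseteq> fst (K i) \<union> snd (K j)"
      using Z P by (auto simp: opp_def)
    then show ?thesis
    proof
      assume a: "S \<subseteq> snd (K i) \<union> fst (K j)"
      have "L j i" "\<not> L i j"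
        using a ij irr(2)[OF ij(1)] irr(1)[OF ij(2)] nL[OF ij] by (auto simp: L_def)
      moreover have "L j k" if k: "k \<in> S" "L i k" for k
      proof -
        have "k \<noteq> i" using k irr(1) by blast
        then have "k \<notin> snd (K i)" using nL[OF ij(1) k(1)] k by blast
        then show ?thesis using a k by (auto simp: L_def)
      qed
      ultimately show ?thesis by blast
    next
      assume a: "S \<subseteq> fst (K i) \<union> snd (K j)"
      have "L i j" "\<not> L j i"
        using a ij irr(2)[OF ij(2)] irr(1)[OF ij(1)] nL[OF ij(2,1)] by (auto simp: L_def)
      moreover have "L i k" if k: "k \<in> S" "L j k" for k
      proof -
        have "k \<noteq> j" using k irr(1) by blast
        then have "k \<notin> snd (K j)" using nL[OF ij(2) k(1)] k by blast
        then show ?thesis using a k by (auto simp: L_def)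
      qed
      ultimately show ?thesis by blast
    qed
  qed
  have asym: "\<not> L j i" if "L i j" "i \<in> S" "j \<in> S" for i j
    using elim[of i j] irr(1)[of i] that by blast
  have "\<exists>xs. set xs = S \<and> distinct xs \<and> sorted_wrt L xs"
  proof (rule ex_sorted_wrt_tournament[OF finS])
    show "L x y \<or> L y x" if "x \<in> S" "y \<in> S" "x \<noteq> y" for x y
      using elim[OF that] by blast
    show "L x z" if "x \<in> S" "y \<in> S" "z \<in> S" "L x y" "L y z" for x y z
      using elim[of x y] asym[of x y] irr(1)[of x] that by blast
  qed
  then obtain xs where xs: "set xs = S" "distinct xs" "sorted_wrt L xs" by blast
  then have "length xs = 4" using F distinct_card by metis
  then obtain a b c d where abcd: "xs = [a, b, c, d]"
    by (auto simp: length_Suc_conv numeral_eq_Suc)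
  have S: "S = {a, b, c, d}" using xs abcd by auto
  have dist: "a \<noteq> b" "a \<noteq> c" "a \<noteq> d" "b \<noteq> c" "b \<noteq> d" "c \<noteq> d" "q \<noteq> a" "q \<noteq> b" "q \<noteq> c" "q \<noteq> d"
    using xs abcd F S by auto
  have LL: "L a b" "L a c" "L a d" "L b c" "L b d" "L c d" using xs abcd by auto
  have nLL: "\<not> L b a" "\<not> L c a" "\<not> L d a" "\<not> L c b" "\<not> L d b" "\<not> L d c"
    using LL[THEN asym] S by auto
  have pos: "b \<in> fst (K a)" "c \<in> fst (K a)" "d \<in> fst (K a)" "c \<in> fst (K b)" "d \<in> fst (K b)" "d \<in> fst (K c)"
    using LL by (auto simp: L_def)
  have neg: "a \<in> snd (K b)" "a \<in> snd (K c)" "a \<in> snd (K d)" "b \<in> snd (K c)" "b \<in> snd (K d)" "c \<in> snd (K d)"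
    using nLL nL S dist by simp_all
  have qs: "q \<in> snd (K a)" "q \<in> snd (K b)" "q \<in> snd (K c)" "q \<in> snd (K d)" using K(3) S by auto
  have two: "\<not> fst (reorient_set {a, c} X) \<subseteq> {f} \<and> \<not> snd (reorient_set {a, c} X) \<subseteq> {f}"
    if X: "X \<in> {P, K a, K b, K c, K d}" for X f
  proof -
    consider "X = P" | "X = K a" | "X = K b" | "X = K c" | "X = K d" using X by blast
    then show ?thesis
    proof cases
      case 1
      then have "{a, c} \<subseteq> snd (reorient_set {a, c} X)" "{b, d} \<subseteq> fst (reorient_set {a, c} X)"
        using P(3) S dist by (auto simp: reorient_set_def)
      then show ?thesis using dist by blast
    next
      case 2
      then have "{q, c} \<subseteq> snd (reorient_set {a, c} X)" "{b, d} \<subseteq> fst (reorient_set {a, c} X)"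
        using pos neg qs dist by (auto simp: reorient_set_def)
      then show ?thesis using dist by blast
    next
      case 3
      then have "{q, c} \<subseteq> snd (reorient_set {a, c} X)" "{a, d} \<subseteq> fst (reorient_set {a, c} X)"
        using pos neg qs dist by (auto simp: reorient_set_def)
      then show ?thesis using dist by blast
    next
      case 4
      then have "{q, b} \<subseteq> snd (reorient_set {a, c} X)" "{a, d} \<subseteq> fst (reorient_set {a, c} X)"
        using pos neg qs dist by (auto simp: reorient_set_def)
      then show ?thesis using dist by blast
    next
      case 5
      then have "{q, b} \<subseteq> snd (reorient_set {a, c} X)" "{a, c} \<subseteq> fst (reorient_set {a, c} X)"
        using pos neg qs dist by (auto simp: reorient_set_def)
      then show ?thesis using dist by blast
    qed
  qed
  have circ: "\<exists>Y\<in>{P, K a, K b, K c, K d}. X = Y \<or> X = opp Y"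
    if X: "X \<in> \<D>" "supp X \<subseteq> F" for X
  proof -
    have c4: "card (supp X) = 4" using N.card_supp_circuit[OF assms(2) X(1)] assms(1) by simp
    then have "supp X \<noteq> F" using assms(4) by auto
    then obtain i where i: "i \<in> F" "supp X \<subseteq> F - {i}" using X by blast
    define Y where "Y = (if i = q then P else K i)"
    have "supp P = F - {q}" using P F by (auto simp: supp_def)
    then have "Y \<in> \<D>" "supp X \<subseteq> supp Y"
      using i K(1,2)[of i] P F by (auto simp: Y_def)
    moreover have "Y \<in> {P, K a, K b, K c, K d}" using i F S by (auto simp: Y_def)
    ultimately show ?thesis using N.circuit_incomparable[OF X(1)] by blast
  qed
  have no: "\<not> snd X \<subseteq> {f}" if X: "X \<in> reorient {a, c} \<D>" "supp X \<subseteq> F" for X f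
  proof -
    obtain W where W: "W \<in> \<D>" "X = reorient_set {a, c} W"
      using X(1) unfolding reorient_def by blast
    then have "supp W \<subseteq> F" using X(2) by simp
    then obtain Y where Y: "Y \<in> {P, K a, K b, K c, K d}" "W = Y \<or> W = opp Y"
      using circ[OF W(1)] by blast
    have "X = reorient_set {a, c} Y \<or> X = opp (reorient_set {a, c} Y)"
      using W(2) Y(2) by (auto simp: opp_reorient_set)
    then show ?thesis using two[OF Y(1), of f] by (auto simp: opp_def)
  qed
  \<comment> \<open>The composite of the normalisation of \<open>P\<close> and of the alternating reorientation.\<close>
  define A where "A = ({a, c} - B) \<union> (B - {a, c})"
  have "reorient {a, c} \<D> = reorient A \<C>" by (simp add: \<D>_def reorient_comp A_def)
  moreover have "A \<subseteq> F" using F S P0 by (auto simp: A_def B_def supp_def)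
  moreover have "acyclic_mod {} F (reorient {a, c} \<D>)"
    unfolding acyclic_mod_def using no by blast
  moreover have "acyclic_mod {f} (F - {f}) (reorient {a, c} \<D>)" if "f \<in> F" for f
    unfolding acyclic_mod_def using no that by blast
  then have "extremes {} F (reorient {a, c} \<D>) = F"
    by (auto simp: extremes_def)
  ultimately show ?thesis by (intro exI[of _ A]) simp
qed

section \<open>Topes with at least five sides\<close>

lemma five_extremes_subset:
  assumes "r = 3" "F \<subseteq> E" "5 \<le> card F"
  shows "\<exists>A\<subseteq>F. acyclic_mod {} F (reorient A \<C>) \<and> 5 \<le> card (extremes {} F (reorient A \<C>))"
  using assms(2,3)
proof (induction "card F" arbitrary: F rule: less_induct)
  case less
  have "card F \<le> card E" using less.prems finite_ground by (intro card_mono)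
  then have rE: "r \<le> card E" using less.prems assms(1) by simp
  show ?case
  proof (cases "card F = 5")
    case True
    then obtain A where "A \<subseteq> F" "acyclic_mod {} F (reorient A \<C>)"
        "extremes {} F (reorient A \<C>) = F"
      using alternating_five[OF assms(1) rE less.prems(1)] by blast
    then show ?thesis using True by (intro exI[of _ A]) simp
  next
    case False
    obtain e where "e \<in> F" using less.prems by fastforce
    define G where "G = F - {e}"
    have G: "F = insert e G" "e \<notin> G" using \<open>e \<in> F\<close> by (auto simp: G_def)
    have "finite F" using less.prems finite_ground finite_subset by blast
    then have "card F = Suc (card G)" using G by simp
    then have "card G < card F" "5 \<le> card G" "G \<subseteq> E" using False less.prems G by auto
    then obtain A where A: "A \<subseteq> G" "acyclic_mod {} G (reorient A \<C>)"
        "5 \<le> card (extremes {} G (reorient A \<C>))"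
      using less.hyps[of G] by blast
    interpret A: uniform_oriented_matroid r E "reorient A \<C>"
      by (rule uniform_oriented_matroid_reorient)
    obtain A' where A': "A' \<subseteq> {e}" "acyclic_mod {} F (reorient A' (reorient A \<C>))"
        "5 \<le> card (extremes {} F (reorient A' (reorient A \<C>)))"
      using A.five_extremes_insert[OF assms(1) rE _ _ G(2) A(2,3)] G less.prems by auto
    then show ?thesis
      using A(1) G by (intro exI[of _ "(A' - A) \<union> (A - A')"]) (auto simp: reorient_comp)
  qed
qed

theorem tope_of_size_at_least_five:
  assumes "r = 3" "5 \<le> card E"
  shows "\<exists>A. is_tope E \<C> A \<and> 5 \<le> tope_size E \<C> A"
proof -
  obtain A where A: "A \<subseteq> E" "acyclic_mod {} E (reorient A \<C>)"
      "5 \<le> card (extremes {} E (reorient A \<C>))"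
    using five_extremes_subset[OF assms(1) order_refl assms(2)] by blast
  interpret A: oriented_matroid E "reorient A \<C>" by (rule oriented_matroid_reorient)
  show ?thesis
    using A A.om_acyclic_iff A.extremes_eq unfolding is_tope_def tope_size_def by auto
qed

end

theorem proposition4:
  shows "(\<forall>(E :: 'a set) \<C>. uniform_oriented_matroid 3 E \<C> \<and> card E \<ge> 5 \<longrightarrow>
            (\<exists>A. is_tope E \<C> A \<and> tope_size E \<C> A \<ge> 5)) \<and>
         (\<forall>t :: nat. enat (5 + t) \<le> nbar t 2)"
proof (intro conjI allI impI)
  fix E :: "'a set" and \<C>
  assume "uniform_oriented_matroid 3 E \<C> \<and> card E \<ge> 5"
  then show "\<exists>A. is_tope E \<C> A \<and> tope_size E \<C> A \<ge> 5"
    using uniform_oriented_matroid.tope_of_size_at_least_five by blast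
next
  fix t :: nat
  have "\<exists>A\<subseteq>E. om_acyclic (reorient A \<C>) \<and> card (interior_elements E (reorient A \<C>)) \<le> t"
    if "uniform_oriented_matroid (2 + 1) E \<C>" and card: "card E = 5 + t" for E :: "nat set" and \<C>
  proof -
    interpret uniform_oriented_matroid 3 E \<C> using that by simp
    obtain A where A: "is_tope E \<C> A" "5 \<le> tope_size E \<C> A"
      using tope_of_size_at_least_five card by auto
    have "interior_elements E (reorient A \<C>) \<subseteq> E" by (auto simp: interior_elements_def)
    then have "card (E - interior_elements E (reorient A \<C>))
        = card E - card (interior_elements E (reorient A \<C>))"
      using finite_ground by (metis card_Diff_subset finite_subset)
    then show ?thesis using A card unfolding is_tope_def tope_size_def by auto
  qed
  then show "enat (5 + t) \<le> nbar t 2"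
    unfolding nbar_def by (intro Sup_upper imageI) blast
qed

end
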